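(* Let $\bar\varepsilon<2/\lambda_{\max}(\mathbf L_s+\mathbf D_\omega)$. Then for all $\varepsilon\in(0,\bar\varepsilon]$, considering the problems $$\text{(P)}\quad \min_{\mathbf U\in\Sigma}E(\mathbf U),\qquad\qquad \text{(B)}\quad \min_{\mathbf U\in\bar\Sigma}\bar E(\mathbf U),$$ the following hold: (i) Every local or global minimizer $\mathbf U^*$ of (P) is strict and satisfies $\mathbf U^*\in\{0,1\}^{n\times K}$. (ii) Problems (P) and (B) have the same global minimizers, that is, $\operatorname{argmin}_{\mathbf U\in\Sigma}E(\mathbf U)=\operatorname{argmin}_{\mathbf U\in\bar\Sigma}\bar E(\mathbf U)$.
   Context: Setting. $G=(V,E)$ is an undirected connected graph with $n$ vertices and symmetric weighted adjacency matrix $\mathbf W=(w_{ij})\in\mathbb R^{n\times n}$, $w_{ij}\ge 0$. $\mathbf D$ is the diagonal degree matrix with entries $d_i=\sum_j w_{ij}$, assumed invertible, and $\mathbf L_s=\mathbf I-\mathbf D^{-1/2}\mathbf W\mathbf D^{-1/2}$ is the symmetric normalized graph Laplacian. $K>2$ is the number of classes. A nonempty subset of nodes (the fidelity nodes) has known labels: $\omega_i=\omega_0>0$ if $i$ is a fidelity node and $\omega_i=0$ otherwise, and $\mathbf D_\omega=\mathrm{diag}(\omega_1,\dots,\omega_n)$. The matrix $\hat{\mathbf U}=(\hat{\mathbf u}_1,\dots,\hat{\mathbf u}_n)^\top\in\mathbb R^{n\times K}$ has row $\hat{\mathbf u}_i$ equal to the known label (a canonical basis vector of $\mathbb R^K$)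 when $i$ is a fidelity node; the other rows do not affect the energies. $\lambda_{\max}(\cdot)$ denotes the maximum eigenvalue. For $\mathbf U=(\mathbf u_1,\dots,\mathbf u_n)^\top\in\mathbb R^{n\times K}$ and $\varepsilon>0$ define $$\bar E(\mathbf U)=\tfrac12\,\mathrm{trace}(\mathbf U^\top\mathbf L_s\mathbf U)+\tfrac12\|\mathbf D_\omega^{1/2}(\hat{\mathbf U}-\mathbf U)\|_F^2,\qquad E(\mathbf U)=\bar E(\mathbf U)+\frac1\varepsilon\sum_{i=1}^n\mathbf u_i^\top(\mathbf 1-\mathbf u_i),$$ where $\mathbf 1\in\mathbb R^K$ is the all-ones vector. The feasible sets are $$\Sigma=\{\mathbf U\in\mathbb R^{n\times K}:\ \mathbf u_i\in\mathbb R^K_{\ge0},\ \mathbf 1^\top\mathbf u_i=1,\ i=1,\dots,n\},$$ $$\bar\Sigma=\{\mathbf U\in\mathbb R^{n\times K}:\ \mathbf u_i\in\{0,1\}^K,\ \mathbf 1^\top\mathbf u_i=1,\ i=1,\dots,n\}.$$ A (local or global) minimizer $\mathbf U^*$ of $E$ over $\Sigma$ is called strict if it is a strict local minimizer, i.e. $E(\mathbf U)>E(\mathbf U^* )$ for all $\mathbf U\in\Sigma$, $\mathbf U\ne\mathbf U^*$, in some neighborhood of $\mathbf U^*$. *)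

theory Defs
  imports "HOL-Analysis.Analysis"
begin

(* A matrix M :: real^'b^'a has rows M $ i indexed by 'a and columns indexed by 'b. The nodes of
   the graph are the elements of 'n, the classes those of 'k, so that U :: real^'k^'n. *)

definition diag_mat :: "real^'n \<Rightarrow> real^'n^'n" where
  "diag_mat v = (\<chi> i j. if i = j then v $ i else 0)"

definition eigenvalues :: "real^'n^'n \<Rightarrow> real set" where
  "eigenvalues A = {l. \<exists>v. v \<noteq> 0 \<and> A *v v = l *\<^sub>R v}"

(* Only applied to symmetric matrices, for which the set is finite and nonempty. *)
definition lambda_max :: "real^'n^'n \<Rightarrow> real" where
  "lambda_max A = Max (eigenvalues A)"

(* {i, j} is an edge iff W $ i $ j > 0. Loops are not excluded. *)
definition connected_weighted_graph :: "real^'n^'n \<Rightarrow> bool" where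
  "connected_weighted_graph W \<longleftrightarrow>
     transpose W = W \<and> (\<forall>i j. 0 \<le> W $ i $ j) \<and>
     (\<forall>i j. (i, j) \<in> {(a, b). W $ a $ b > 0}\<^sup>*)"

definition degree_vec :: "real^'n^'n \<Rightarrow> real^'n" where
  "degree_vec W = (\<chi> i. \<Sum>j\<in>UNIV. W $ i $ j)"

definition degree_mat :: "real^'n^'n \<Rightarrow> real^'n^'n" where
  "degree_mat W = diag_mat (degree_vec W)"

definition degree_mat_inv_sqrt :: "real^'n^'n \<Rightarrow> real^'n^'n" where
  "degree_mat_inv_sqrt W = diag_mat (\<chi> i. 1 / sqrt (degree_vec W $ i))"

definition sym_laplacian :: "real^'n^'n \<Rightarrow> real^'n^'n" where
  "sym_laplacian W = mat 1 - degree_mat_inv_sqrt W ** W ** degree_mat_inv_sqrt W"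

(* F is the set of fidelity nodes. *)
definition fidelity_weights :: "'n set \<Rightarrow> real \<Rightarrow> real^'n" where
  "fidelity_weights F \<omega>0 = (\<chi> i. if i \<in> F then \<omega>0 else 0)"

definition fidelity_mat :: "'n set \<Rightarrow> real \<Rightarrow> real^'n^'n" where
  "fidelity_mat F \<omega>0 = diag_mat (fidelity_weights F \<omega>0)"

definition fidelity_mat_sqrt :: "'n set \<Rightarrow> real \<Rightarrow> real^'n^'n" where
  "fidelity_mat_sqrt F \<omega>0 = diag_mat (\<chi> i. sqrt (fidelity_weights F \<omega>0 $ i))"

(* The norm of the type real^'k^'n is the Frobenius norm. *)
lemma norm_matrix_eq_frobenius:
  fixes A :: "real^'k^'n"
  shows "norm A = sqrt (\<Sum>i\<in>UNIV. \<Sum>j\<in>UNIV. (A $ i $ j)\<^sup>2)"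
  by (simp add: norm_vec_def L2_set_def sum_nonneg)

definition energy_bar ::
    "real^'n^'n \<Rightarrow> 'n set \<Rightarrow> real \<Rightarrow> real^'k^'n \<Rightarrow> real^'k^'n \<Rightarrow> real" where
  "energy_bar W F \<omega>0 Uhat U =
     1/2 * trace (transpose U ** sym_laplacian W ** U)
     + 1/2 * (norm (fidelity_mat_sqrt F \<omega>0 ** (Uhat - U)))\<^sup>2"

(* The vector 1 :: real^'k is the all-ones vector. *)
definition energy ::
    "real^'n^'n \<Rightarrow> 'n set \<Rightarrow> real \<Rightarrow> real^'k^'n \<Rightarrow> real \<Rightarrow> real^'k^'n \<Rightarrow> real" where
  "energy W F \<omega>0 Uhat \<epsilon> U =
     energy_bar W F \<omega>0 Uhat U + 1/\<epsilon> * (\<Sum>i\<in>UNIV. U $ i \<bullet> (1 - U $ i))"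

definition simplex_set :: "(real^'k^'n) set" where
  "simplex_set = {U. \<forall>i. (\<forall>j. 0 \<le> U $ i $ j) \<and> 1 \<bullet> U $ i = 1}"

definition binary_matrices :: "(real^'k^'n) set" where
  "binary_matrices = {U. \<forall>i j. U $ i $ j \<in> {0, 1}}"

definition binary_simplex_set :: "(real^'k^'n) set" where
  "binary_simplex_set = {U. \<forall>i. (\<forall>j. U $ i $ j \<in> {0, 1}) \<and> 1 \<bullet> U $ i = 1}"

definition global_minimizers :: "('a \<Rightarrow> real) \<Rightarrow> 'a set \<Rightarrow> 'a set" where
  "global_minimizers f S = {x. is_arg_min f (\<lambda>y. y \<in> S) x}"

(* The filter "at x within S" ranges over neighbourhoods of x in S with x itself removed. *)
definition local_minimizer :: "('a::topological_space \<Rightarrow> real) \<Rightarrow> 'a set \<Rightarrow> 'a \<Rightarrow> bool" where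
  "local_minimizer f S x \<longleftrightarrow> x \<in> S \<and> (\<forall>\<^sub>F y in at x within S. f x \<le> f y)"

definition strict_local_minimizer ::
    "('a::topological_space \<Rightarrow> real) \<Rightarrow> 'a set \<Rightarrow> 'a \<Rightarrow> bool" where
  "strict_local_minimizer f S x \<longleftrightarrow> x \<in> S \<and> (\<forall>\<^sub>F y in at x within S. f x < f y)"

end

theory Submission
  imports Defs
begin

text \<open>
  The bound on \<open>\<epsilon>\<close> says that \<open>\<lambda> < 2 / \<epsilon>\<close> for the largest eigenvalue \<open>\<lambda>\<close> of
  \<open>A = L\<^sub>s + D\<^sub>\<omega>\<close>. The energy is a quadratic function of \<open>U\<close> with Hessian \<open>A - (2 / \<epsilon>) I\<close> acting on
  each column, so it is strictly concave. On a polytope such as \<open>simplex_set\<close> this has three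
  consequences, from which the theorem follows.

  A local minimizer cannot be the midpoint of a short segment in the polytope
  (\<open>local_minimizer_imp_binary\<close>), so it is a vertex, and the vertices are the binary matrices.

  Near a vertex \<open>U\<close>, every feasible \<open>Y\<close> is the midpoint of \<open>U\<close> and another feasible point
  \<open>2 Y - U\<close>, also near \<open>U\<close>. If \<open>U\<close> is a local minimizer, strict concavity therefore puts the value at
  \<open>Y\<close> strictly above the value at \<open>U\<close> (\<open>local_minimizer_imp_strict\<close>).

  By compactness a global minimizer over the polytope exists, and it is a vertex. The penalty
  vanishes at vertices, so the relaxed and the binary problem have the same minimal value and the
  same minimizers.

  Concavity is used only in the form that the value at the midpoint of two distinct points exceeds
  the mean of the values (\<open>energy_strictly_midpoint_concave\<close>). This form is an exact identity for
  quadratic functions, combined with the bound \<open>x \<bullet> A x \<le> \<lambda> \<parallel>x\<parallel>\<^sup>2\<close> for symmetric \<open>A\<close>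
  (\<open>rayleigh_le_lambda_max\<close>).
\<close>

section \<open>The Rayleigh quotient of a symmetric matrix\<close>

lemma symmetric_inner_swap:
  fixes A :: "real^'n^'n"
  assumes "transpose A = A"
  shows "x \<bullet> (A *v y) = (A *v x) \<bullet> y"
  using assms by (metis dot_lmul_matrix vector_transpose_matrix)

text \<open>Eigenvectors for different eigenvalues are orthogonal, so there are at most as many
  eigenvalues as dimensions.\<close>

lemma finite_eigenvalues:
  fixes A :: "real^'n^'n"
  assumes sym: "transpose A = A"
  shows "finite (eigenvalues A)"
proof -
  have "\<forall>l\<in>eigenvalues A. \<exists>v. v \<noteq> 0 \<and> A *v v = l *\<^sub>R v"
    by (auto simp: eigenvalues_def)
  then obtain e where e: "\<And>l. l \<in> eigenvalues A \<Longrightarrow> e l \<noteq> 0 \<and> A *v e l = l *\<^sub>R e l"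
    by metis
  have orth: "e l \<bullet> e m = 0" if "l \<in> eigenvalues A" "m \<in> eigenvalues A" "l \<noteq> m" for l m
  proof -
    have "m * (e l \<bullet> e m) = l * (e l \<bullet> e m)"
      using symmetric_inner_swap[OF sym, of "e l" "e m"] e that by simp
    with \<open>l \<noteq> m\<close> show ?thesis by simp
  qed
  have inj: "inj_on e (eigenvalues A)"
    using e orth by (metis inj_onI inner_eq_zero_iff)
  have "pairwise orthogonal (e ` eigenvalues A)"
    using orth by (auto simp: pairwise_def orthogonal_def)
  moreover have "0 \<notin> e ` eigenvalues A"
    using e by force
  ultimately have "finite (e ` eigenvalues A)"
    by (meson independent_imp_finite pairwise_orthogonal_independent)
  with inj show ?thesis
    using finite_imageD by blast
qed

text \<open>A zero \<open>x\<close> of the quadratic form minimizes it, so its derivative at \<open>x\<close> in the direction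
  \<open>B x\<close>, which is twice the square of \<open>\<parallel>B x\<parallel>\<close>, vanishes.\<close>

lemma psd_form_zero_imp_kernel:
  fixes B :: "real^'n^'n"
  assumes sym: "transpose B = B" and psd: "\<And>y. 0 \<le> y \<bullet> (B *v y)" and zero: "x \<bullet> (B *v x) = 0"
  shows "B *v x = 0"
proof (rule ccontr)
  define z where "z = B *v x"
  define p where "p = z \<bullet> (B *v z)"
  assume "B *v x \<noteq> 0"
  then have zz: "z \<bullet> z > 0" by (simp add: z_def)
  have expand: "(x + t *\<^sub>R z) \<bullet> (B *v (x + t *\<^sub>R z)) = 2 * t * (z \<bullet> z) + t\<^sup>2 * p" for t
  proof -
    have "x \<bullet> (B *v z) = z \<bullet> z"
      using symmetric_inner_swap[OF sym, of x z] by (simp add: z_def)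
    then show ?thesis
      using zero by (simp add: matrix_vector_right_distrib matrix_vector_mult_scaleR
          inner_add_left inner_add_right p_def power2_eq_square algebra_simps flip: z_def)
  qed
  \<comment> \<open>A small negative \<open>t\<close> makes the linear term win; adding 1 keeps the denominator positive.\<close>
  define t where "t = - (z \<bullet> z) / (p + 1)"
  have p0: "p \<ge> 0" using psd p_def by simp
  have "z \<bullet> z = - t * (p + 1)" and "t \<noteq> 0"
    using p0 zz by (auto simp: t_def)
  then have "2 * t * (z \<bullet> z) + t\<^sup>2 * p = - (t\<^sup>2 * (p + 2))"
    by (simp only: \<open>z \<bullet> z = - t * (p + 1)\<close>) (simp add: power2_eq_square algebra_simps)
  also have "\<dots> < 0"
    using p0 \<open>t \<noteq> 0\<close> by simp
  finally show False
    using psd[of "x + t *\<^sub>R z"] expand[of t] by simp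
qed

text \<open>The form attains its maximum \<open>m\<close> over the unit sphere at some \<open>v\<close>. The form of \<open>m I - A\<close> is
  then nonnegative and vanishes at \<open>v\<close>, so \<open>v\<close> is an eigenvector and \<open>m\<close> an eigenvalue.\<close>

lemma rayleigh_le_lambda_max:
  fixes A :: "real^'n^'n"
  assumes sym: "transpose A = A"
  shows "x \<bullet> (A *v x) \<le> lambda_max A * (x \<bullet> x)"
proof -
  have "compact (sphere 0 1 :: (real^'n) set)" "(sphere 0 1 :: (real^'n) set) \<noteq> {}"
    by auto
  moreover have "continuous_on (sphere 0 1) (\<lambda>y. y \<bullet> (A *v y))"
    by (intro continuous_intros)
  ultimately obtain v where v: "v \<in> sphere 0 1"
    and vmax: "\<And>y. y \<in> sphere 0 1 \<Longrightarrow> y \<bullet> (A *v y) \<le> v \<bullet> (A *v v)"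
    by (meson continuous_attains_sup)
  define m where "m = v \<bullet> (A *v v)"
  have bound: "y \<bullet> (A *v y) \<le> m * (y \<bullet> y)" for y
  proof (cases "y = 0")
    case False
    define u where "u = (1 / norm y) *\<^sub>R y"
    have "u \<in> sphere 0 1" using False by (simp add: u_def)
    moreover have y: "y = norm y *\<^sub>R u" using False by (simp add: u_def)
    ultimately have "u \<bullet> (A *v u) \<le> m" using vmax m_def by auto
    moreover have "y \<bullet> (A *v y) = (norm y)\<^sup>2 * (u \<bullet> (A *v u))"
      by (subst (1 2) y) (simp add: matrix_vector_mult_scaleR power2_eq_square)
    ultimately show ?thesis
      by (simp add: power2_norm_eq_inner mult_left_mono mult.commute[of m])
  qed auto
  define B where "B = m *\<^sub>R mat 1 - A"
  have B: "B *v y = m *\<^sub>R y - A *v y" for y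
    by (simp add: B_def matrix_vector_mult_diff_rdistrib scaleR_matrix_vector_assoc[symmetric])
  have "transpose B = B"
    using sym by (simp add: B_def transpose_def mat_def vec_eq_iff)
  moreover have "0 \<le> y \<bullet> (B *v y)" for y
    using bound[of y] by (simp add: B inner_diff_right)
  moreover have "v \<bullet> (B *v v) = 0"
    using v by (simp add: B inner_diff_right m_def norm_eq_1)
  ultimately have "B *v v = 0"
    by (rule psd_form_zero_imp_kernel)
  then have "m \<in> eigenvalues A"
    using v unfolding eigenvalues_def B by (auto intro!: exI[of _ v])
  then have "m \<le> lambda_max A"
    unfolding lambda_max_def using finite_eigenvalues[OF sym] by simp
  then show ?thesis
    using bound[of x] by (meson inner_ge_zero mult_right_mono order_trans)
qed

section \<open>Matrices under the Frobenius inner product\<close>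

lemma inner_matrix_columns:
  fixes U V :: "real^'k^'n"
  shows "U \<bullet> V = (\<Sum>c\<in>UNIV. column c U \<bullet> column c V)"
  unfolding inner_vec_def column_def by (subst sum.swap) simp

lemma column_matrix_mult: "column c (A ** U) = A *v column c U"
  for A :: "real^'n^'m" and U :: "real^'k^'n"
  by (simp add: column_def matrix_matrix_mult_def matrix_vector_mult_def vec_eq_iff)

lemma matrix_rayleigh_le_lambda_max:
  fixes A :: "real^'n^'n" and U :: "real^'k^'n"
  assumes "transpose A = A"
  shows "U \<bullet> (A ** U) \<le> lambda_max A * (U \<bullet> U)"
  unfolding inner_matrix_columns column_matrix_mult sum_distrib_left
  by (intro sum_mono rayleigh_le_lambda_max assms)

lemma trace_eq_inner:
  fixes A :: "real^'n^'n" and U :: "real^'k^'n"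
  shows "trace (transpose U ** A ** U) = U \<bullet> (A ** U)"
  unfolding inner_matrix_columns matrix_mul_assoc[symmetric]
  by (simp add: trace_def inner_vec_def column_def transpose_def matrix_matrix_mult_def)

lemma linear_matrix_mult_left: "linear (\<lambda>U. A ** U)"
  for A :: "real^'n^'m"
  by (rule linearI) (simp_all add: matrix_add_ldistrib matrix_scalar_ac scalar_mult_eq_scaleR
      scaleR_right.sum sum_distrib_left matrix_matrix_mult_def vec_eq_iff algebra_simps sum.distrib)

lemma matrix_mult_add_left: "(A + B) ** C = A ** C + B ** C"
  for A B :: "real^'n^'m"
  by (simp add: matrix_matrix_mult_def vec_eq_iff distrib_right sum.distrib)

lemma diag_mat_mult_row: "(diag_mat v ** U) $ i = v $ i *\<^sub>R U $ i"
  by (simp add: diag_mat_def matrix_matrix_mult_def vec_eq_iff if_distrib[of "\<lambda>c. c * _"]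
      cong: if_cong)

lemma transpose_diag_mat: "transpose (diag_mat v) = diag_mat v"
  by (simp add: diag_mat_def transpose_def vec_eq_iff)

lemma norm_fidelity_mat_sqrt:
  fixes Z :: "real^'k^'n"
  assumes "\<omega>0 > 0"
  shows "(norm (fidelity_mat_sqrt F \<omega>0 ** Z))\<^sup>2 = Z \<bullet> (fidelity_mat F \<omega>0 ** Z)"
proof -
  have "sqrt (fidelity_weights F \<omega>0 $ i) * sqrt (fidelity_weights F \<omega>0 $ i)
      = fidelity_weights F \<omega>0 $ i" for i
    using assms by (simp add: fidelity_weights_def)
  then show ?thesis
    unfolding power2_norm_eq_inner inner_vec_def[of "fidelity_mat_sqrt F \<omega>0 ** Z"]
      inner_vec_def[of Z]
    by (simp add: fidelity_mat_sqrt_def fidelity_mat_def diag_mat_mult_row flip: mult.assoc)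
qed

lemma transpose_sym_laplacian_plus_fidelity:
  assumes "transpose W = W"
  shows "transpose (sym_laplacian W + fidelity_mat F \<omega>0) = sym_laplacian W + fidelity_mat F \<omega>0"
proof -
  have "transpose (degree_mat_inv_sqrt W ** W ** degree_mat_inv_sqrt W)
      = degree_mat_inv_sqrt W ** W ** degree_mat_inv_sqrt W"
    using assms by (simp add: matrix_transpose_mul matrix_mul_assoc degree_mat_inv_sqrt_def
        transpose_diag_mat)
  moreover have "transpose (fidelity_mat F \<omega>0) = fidelity_mat F \<omega>0"
    by (simp add: fidelity_mat_def transpose_diag_mat)
  ultimately show ?thesis
    unfolding sym_laplacian_def by (simp add: transpose_def mat_def vec_eq_iff)
qed

section \<open>Strict concavity of the energy\<close>

text \<open>This is the parallelogram law: the mixed terms \<open>X \<bullet> T Y\<close> and \<open>Y \<bullet> T X\<close> enter both sides with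
  the same coefficients, whether or not they are equal.\<close>

lemma quadratic_form_midpoint:
  fixes T :: "'a::real_inner \<Rightarrow> 'a"
  assumes "linear T"
  shows "X \<bullet> T X + Y \<bullet> T Y - 2 * (midpoint X Y \<bullet> T (midpoint X Y))
    = 1/2 * ((X - Y) \<bullet> T (X - Y))"
  by (simp add: midpoint_def linear_add[OF assms] linear_diff[OF assms] linear_scale[OF assms]
      inner_add_left inner_add_right inner_diff_left inner_diff_right algebra_simps)

lemma energy_eq:
  fixes U :: "real^'k^'n"
  shows "energy W F \<omega>0 Uhat \<epsilon> U = 1/2 * (U \<bullet> (sym_laplacian W ** U))
    + 1/2 * (norm (fidelity_mat_sqrt F \<omega>0 ** (Uhat - U)))\<^sup>2
    + 1/\<epsilon> * (U \<bullet> 1) - 1/\<epsilon> * (U \<bullet> U)"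
proof -
  have "(\<Sum>i\<in>UNIV. U $ i \<bullet> (1 - U $ i)) = U \<bullet> (1 - U)"
    by (simp add: inner_vec_def[of U])
  then show ?thesis
    unfolding energy_def energy_bar_def trace_eq_inner
    by (simp add: inner_diff_right right_diff_distrib diff_divide_distrib)
qed

lemma energy_midpoint:
  fixes X Y :: "real^'k^'n"
  assumes "\<omega>0 > 0"
  shows "energy W F \<omega>0 Uhat \<epsilon> X + energy W F \<omega>0 Uhat \<epsilon> Y - 2 * energy W F \<omega>0 Uhat \<epsilon> (midpoint X Y)
    = 1/4 * ((X - Y) \<bullet> ((sym_laplacian W + fidelity_mat F \<omega>0) ** (X - Y)))
      - 1/(2 * \<epsilon>) * ((X - Y) \<bullet> (X - Y))"
proof -
  define L where "L = sym_laplacian W"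
  define D where "D = fidelity_mat F \<omega>0"
  have lap: "X \<bullet> (L ** X) + Y \<bullet> (L ** Y) - 2 * (midpoint X Y \<bullet> (L ** midpoint X Y))
      = 1/2 * ((X - Y) \<bullet> (L ** (X - Y)))"
    by (rule quadratic_form_midpoint[OF linear_matrix_mult_left])
  \<comment> \<open>\<open>U \<mapsto> Uhat - U\<close> is affine, so it commutes with midpoints.\<close>
  have mid: "midpoint (Uhat - X) (Uhat - Y) = Uhat - midpoint X Y"
    by (simp add: midpoint_def vec_eq_iff field_simps)
  have "(Uhat - X) - (Uhat - Y) = - (X - Y)"
    by simp
  then have fid: "(Uhat - X) \<bullet> (D ** (Uhat - X)) + (Uhat - Y) \<bullet> (D ** (Uhat - Y))
      - 2 * ((Uhat - midpoint X Y) \<bullet> (D ** (Uhat - midpoint X Y)))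
      = 1/2 * ((X - Y) \<bullet> (D ** (X - Y)))"
    using quadratic_form_midpoint[OF linear_matrix_mult_left, of "Uhat - X" D "Uhat - Y"]
    by (simp only: mid linear_neg[OF linear_matrix_mult_left] inner_minus_left inner_minus_right
        minus_minus)
  have lin: "X \<bullet> 1 + Y \<bullet> 1 - 2 * (midpoint X Y \<bullet> 1) = 0"
    by (simp add: midpoint_def inner_add_left)
  have sq: "X \<bullet> X + Y \<bullet> Y - 2 * (midpoint X Y \<bullet> midpoint X Y) = 1/2 * ((X - Y) \<bullet> (X - Y))"
    by (rule quadratic_form_midpoint[of "\<lambda>x. x"]) (simp add: linear_iff)
  have "energy W F \<omega>0 Uhat \<epsilon> X + energy W F \<omega>0 Uhat \<epsilon> Y - 2 * energy W F \<omega>0 Uhat \<epsilon> (midpoint X Y)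
    = 1/2 * (X \<bullet> (L ** X) + Y \<bullet> (L ** Y) - 2 * (midpoint X Y \<bullet> (L ** midpoint X Y)))
    + 1/2 * ((Uhat - X) \<bullet> (D ** (Uhat - X)) + (Uhat - Y) \<bullet> (D ** (Uhat - Y))
      - 2 * ((Uhat - midpoint X Y) \<bullet> (D ** (Uhat - midpoint X Y))))
    + 1/\<epsilon> * (X \<bullet> 1 + Y \<bullet> 1 - 2 * (midpoint X Y \<bullet> 1))
    - 1/\<epsilon> * (X \<bullet> X + Y \<bullet> Y - 2 * (midpoint X Y \<bullet> midpoint X Y))"
    unfolding energy_eq norm_fidelity_mat_sqrt[OF assms] L_def[symmetric] D_def[symmetric]
    by (simp add: algebra_simps)
  also have "\<dots> = 1/4 * ((X - Y) \<bullet> ((L + D) ** (X - Y))) - 1/(2 * \<epsilon>) * ((X - Y) \<bullet> (X - Y))"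
    unfolding lap fid lin sq by (simp add: matrix_mult_add_left inner_add_right field_simps)
  finally show ?thesis
    by (simp add: L_def D_def)
qed

lemma energy_strictly_midpoint_concave:
  fixes X Y :: "real^'k^'n"
  assumes "transpose W = W" "\<omega>0 > 0" "\<epsilon> > 0"
    and small: "lambda_max (sym_laplacian W + fidelity_mat F \<omega>0) < 2 / \<epsilon>"
    and "X \<noteq> Y"
  shows "energy W F \<omega>0 Uhat \<epsilon> X + energy W F \<omega>0 Uhat \<epsilon> Y
    < 2 * energy W F \<omega>0 Uhat \<epsilon> (midpoint X Y)"
proof -
  let ?A = "sym_laplacian W + fidelity_mat F \<omega>0" and ?Z = "X - Y"
  have "?Z \<bullet> (?A ** ?Z) \<le> lambda_max ?A * (?Z \<bullet> ?Z)"
    by (intro matrix_rayleigh_le_lambda_max transpose_sym_laplacian_plus_fidelity assms)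
  also have "\<dots> < 2 / \<epsilon> * (?Z \<bullet> ?Z)"
    using small \<open>X \<noteq> Y\<close> by (intro mult_strict_right_mono) auto
  finally have "1/4 * (?Z \<bullet> (?A ** ?Z)) - 1/(2 * \<epsilon>) * (?Z \<bullet> ?Z) < 0"
    by simp
  then show ?thesis
    using energy_midpoint[OF \<open>\<omega>0 > 0\<close>, of W F Uhat \<epsilon> X Y] by linarith
qed

lemma continuous_on_energy: "continuous_on S (energy W F \<omega>0 Uhat \<epsilon>)"
  unfolding energy_eq
  by (intro continuous_intros linear_continuous_on_compose[OF _ linear_matrix_mult_left])

section \<open>The polytope of row-stochastic matrices\<close>

lemma simplex_set_iff:
  "U \<in> simplex_set \<longleftrightarrow> (\<forall>i j. 0 \<le> U $ i $ j) \<and> (\<forall>i. (\<Sum>j\<in>UNIV. U $ i $ j) = 1)"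
  by (auto simp: simplex_set_def inner_vec_def)

lemma binary_simplex_set_eq: "binary_simplex_set = simplex_set \<inter> binary_matrices"
  unfolding binary_simplex_set_def simplex_set_def binary_matrices_def
proof (intro set_eqI iffI; clarsimp)
  fix U :: "real^'k^'n" and i j
  assume "\<forall>i. (\<forall>j. U $ i $ j = 0 \<or> U $ i $ j = 1) \<and> 1 \<bullet> U $ i = 1"
  then have "U $ i $ j = 0 \<or> U $ i $ j = 1" by blast
  then show "0 \<le> U $ i $ j" by auto
qed

lemma simplex_entry_le_one:
  assumes "U \<in> simplex_set"
  shows "U $ i $ j \<le> 1"
  using assms member_le_sum[of j UNIV "\<lambda>j. U $ i $ j"] by (auto simp: simplex_set_iff)

lemma simplex_set_nonempty: "(simplex_set :: (real^'k^'n) set) \<noteq> {}"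
proof -
  have "(\<chi> i. (axis undefined 1 :: real^'k)) \<in> (simplex_set :: (real^'k^'n) set)"
    by (simp add: simplex_set_iff axis_def)
  then show ?thesis by blast
qed

lemma compact_simplex_set: "compact (simplex_set :: (real^'k^'n) set)"
proof -
  have "(simplex_set :: (real^'k^'n) set)
      = (\<Inter>i. \<Inter>j. {U. 0 \<le> U $ i $ j}) \<inter> (\<Inter>i. {U. (\<Sum>j\<in>UNIV. U $ i $ j) = 1})"
    by (auto simp: simplex_set_iff)
  moreover have "closed \<dots>"
    by (intro closed_Int closed_INT ballI closed_Collect_le closed_Collect_eq continuous_intros)
  ultimately have "closed (simplex_set :: (real^'k^'n) set)"
    by simp
  moreover have "bounded (simplex_set :: (real^'k^'n) set)"
  proof (rule boundedI)
    fix U :: "real^'k^'n" assume U: "U \<in> simplex_set"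
    have "norm U \<le> (\<Sum>i\<in>UNIV. norm (U $ i))"
      unfolding norm_vec_def[of U] by (rule L2_set_le_sum) simp
    also have "\<dots> \<le> (\<Sum>i\<in>UNIV. \<Sum>j\<in>UNIV. \<bar>U $ i $ j\<bar>)"
      by (intro sum_mono norm_le_l1_cart)
    also have "\<dots> = real CARD('n)"
      using U by (simp add: simplex_set_iff)
    finally show "norm U \<le> real CARD('n)" .
  qed
  ultimately show ?thesis
    by (simp add: compact_eq_bounded_closed)
qed

text \<open>A fractional entry is not alone in its row, because the row sums to 1. Moving mass back and
  forth between two fractional entries of one row gives a segment inside the polytope.\<close>

lemma nonbinary_simplex_direction:
  fixes U :: "real^'k^'n"
  assumes U: "U \<in> simplex_set" and nb: "U \<notin> binary_matrices"
  obtains V :: "real^'k^'n" and s :: real where "V \<noteq> 0" "s > 0"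
    "\<And>t. \<bar>t\<bar> \<le> s \<Longrightarrow> U + t *\<^sub>R V \<in> simplex_set"
proof -
  obtain i a where "U $ i $ a \<noteq> 0" "U $ i $ a \<noteq> 1"
    using nb by (auto simp: binary_matrices_def)
  with U have a: "0 < U $ i $ a" "U $ i $ a < 1"
    using simplex_entry_le_one[OF U, of i a] by (auto simp: simplex_set_iff less_le)
  have "(\<Sum>j\<in>UNIV. U $ i $ j) = U $ i $ a + (\<Sum>j\<in>UNIV - {a}. U $ i $ j)"
    by (rule sum.remove) auto
  then have "(\<Sum>j\<in>UNIV - {a}. U $ i $ j) \<noteq> 0"
    using U a by (simp add: simplex_set_iff)
  then obtain b where "b \<noteq> a" "U $ i $ b \<noteq> 0"
    by (metis (mono_tags, lifting) Diff_iff singletonI sum.neutral)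
  with U have b: "b \<noteq> a" "0 < U $ i $ b"
    by (auto simp: simplex_set_iff less_le)
  define V :: "real^'k^'n" where "V = axis i (axis a 1 - axis b 1)"
  define s where "s = min (U $ i $ a) (U $ i $ b)"
  have V: "V $ p $ q = (if p = i then (if q = a then 1 else 0) - (if q = b then 1 else 0) else 0)"
    for p q by (simp add: V_def axis_def)
  have "V \<noteq> 0"
    using V[of i a] b by auto
  moreover have "s > 0" using a b by (simp add: s_def)
  moreover have "U + t *\<^sub>R V \<in> simplex_set" if "\<bar>t\<bar> \<le> s" for t
  proof -
    have "0 \<le> (U + t *\<^sub>R V) $ p $ q" for p q
      using U that b by (auto simp: V simplex_set_iff s_def)
    moreover have "(\<Sum>q\<in>UNIV. (U + t *\<^sub>R V) $ p $ q) = 1" for p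
    proof -
      have "(\<Sum>q\<in>UNIV. V $ p $ q) = 0"
        by (cases "p = i") (simp_all add: V sum_subtractf)
      then show ?thesis
        using U by (simp add: simplex_set_iff sum.distrib flip: sum_distrib_left)
    qed
    ultimately show ?thesis by (simp add: simplex_set_iff)
  qed
  ultimately show ?thesis using that by blast
qed

text \<open>Reflecting \<open>U\<close> in \<open>Y\<close> does not decrease an entry where \<open>U\<close> is 0, and lowers an entry where
  \<open>U\<close> is 1 by at most twice the distance.\<close>

lemma binary_simplex_reflection:
  fixes U Y :: "real^'k^'n"
  assumes "U \<in> simplex_set" "U \<in> binary_matrices" "Y \<in> simplex_set" and near: "dist Y U \<le> 1/2"
  shows "2 *\<^sub>R Y - U \<in> simplex_set"
proof -
  have "0 \<le> (2 *\<^sub>R Y - U) $ i $ j" for i j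
  proof -
    have "\<bar>(Y - U) $ i $ j\<bar> \<le> norm (Y - U)"
      by (rule order_trans[OF component_le_norm_cart Finite_Cartesian_Product.norm_nth_le])
    then have "\<bar>Y $ i $ j - U $ i $ j\<bar> \<le> 1/2"
      using near by (simp add: dist_norm)
    moreover have "0 \<le> Y $ i $ j" "U $ i $ j = 0 \<or> U $ i $ j = 1"
      using assms by (auto simp: simplex_set_iff binary_matrices_def)
    ultimately have "0 \<le> 2 * Y $ i $ j - U $ i $ j" by linarith
    then show ?thesis by simp
  qed
  moreover have "(\<Sum>j\<in>UNIV. (2 *\<^sub>R Y - U) $ i $ j) = 1" for i
    using assms by (simp add: simplex_set_iff sum_subtractf flip: sum_distrib_left)
  ultimately show ?thesis by (simp add: simplex_set_iff)
qed

section \<open>Minimizers of strictly concave functions on the polytope\<close>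

lemma local_minimizer_iff_dist:
  fixes f :: "'a::metric_space \<Rightarrow> real"
  shows "local_minimizer f S x \<longleftrightarrow> x \<in> S \<and> (\<exists>d>0. \<forall>y\<in>S. dist y x < d \<longrightarrow> f x \<le> f y)"
  unfolding local_minimizer_def eventually_at by force

lemma global_minimizers_iff:
  fixes f :: "'a \<Rightarrow> real"
  shows "x \<in> global_minimizers f S \<longleftrightarrow> x \<in> S \<and> (\<forall>y\<in>S. f x \<le> f y)"
  by (auto simp: global_minimizers_def is_arg_min_linorder)

lemma global_minimizer_imp_local:
  fixes f :: "'a::metric_space \<Rightarrow> real"
  assumes "x \<in> global_minimizers f S"
  shows "local_minimizer f S x"
  using assms by (auto simp: global_minimizers_iff local_minimizer_iff_dist intro!: exI[of _ 1])

lemma local_minimizer_imp_binary: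
  fixes f :: "real^'k^'n \<Rightarrow> real"
  assumes concave: "\<And>X Y. X \<noteq> Y \<Longrightarrow> f X + f Y < 2 * f (midpoint X Y)"
    and min: "local_minimizer f simplex_set U"
  shows "U \<in> binary_matrices"
proof (rule ccontr)
  obtain d where U: "U \<in> simplex_set" and "d > 0"
    and d: "\<And>Y. Y \<in> simplex_set \<Longrightarrow> dist Y U < d \<Longrightarrow> f U \<le> f Y"
    using min by (auto simp: local_minimizer_iff_dist)
  assume "U \<notin> binary_matrices"
  with U obtain V s where V: "V \<noteq> 0" and "s > 0"
    and s: "\<And>t. \<bar>t\<bar> \<le> s \<Longrightarrow> U + t *\<^sub>R V \<in> simplex_set"
    using nonbinary_simplex_direction by metis
  define t where "t = min s (d / (2 * norm V))"
  have t: "t > 0" "t \<le> s"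
    using V \<open>s > 0\<close> \<open>d > 0\<close> by (auto simp: t_def)
  have "t * norm V \<le> d / 2"
    using V by (simp add: t_def min_def field_simps)
  then have tV: "t * norm V < d"
    using \<open>d > 0\<close> by simp
  have "f U \<le> f (U + t *\<^sub>R V)" "f U \<le> f (U + (- t) *\<^sub>R V)"
    using t tV by (auto intro!: d s simp: dist_norm simp del: scaleR_minus_left)
  moreover have "U + t *\<^sub>R V \<noteq> U + (- t) *\<^sub>R V"
    using t V by (simp add: eq_neg_iff_add_eq_0 flip: scaleR_2)
  moreover have "midpoint (U + t *\<^sub>R V) (U + (- t) *\<^sub>R V) = U"
    by (simp add: midpoint_def flip: scaleR_2)
  ultimately show False
    using concave[of "U + t *\<^sub>R V" "U + (- t) *\<^sub>R V"] by simp
qed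

lemma local_minimizer_imp_strict:
  fixes f :: "real^'k^'n \<Rightarrow> real"
  assumes concave: "\<And>X Y. X \<noteq> Y \<Longrightarrow> f X + f Y < 2 * f (midpoint X Y)"
    and min: "local_minimizer f simplex_set U"
  shows "strict_local_minimizer f simplex_set U"
proof -
  obtain d where U: "U \<in> simplex_set" and "d > 0"
    and d: "\<And>Y. Y \<in> simplex_set \<Longrightarrow> dist Y U < d \<Longrightarrow> f U \<le> f Y"
    using min by (auto simp: local_minimizer_iff_dist)
  have bin: "U \<in> binary_matrices"
    using local_minimizer_imp_binary[OF concave min] .
  have "f U < f Y" if Y: "Y \<in> simplex_set" "Y \<noteq> U" "dist Y U < min (1/2) (d/2)" for Y
  proof -
    let ?R = "2 *\<^sub>R Y - U"
    have R: "?R - U = 2 *\<^sub>R (Y - U)"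
      by (simp add: scaleR_2)
    then have "dist ?R U < d"
      using Y by (simp add: dist_norm)
    then have "f U \<le> f ?R"
      using Y by (intro d binary_simplex_reflection U bin) auto
    moreover have "midpoint U ?R = Y"
      by (simp add: midpoint_def)
    moreover have "U \<noteq> ?R"
      using R Y by auto
    ultimately show ?thesis
      using concave[of U ?R] by simp
  qed
  then show ?thesis
    unfolding strict_local_minimizer_def eventually_at using U \<open>d > 0\<close>
    by (auto intro!: exI[of _ "min (1/2) (d/2)"])
qed

lemma energy_eq_energy_bar:
  assumes "U \<in> binary_matrices"
  shows "energy W F \<omega>0 Uhat \<epsilon> U = energy_bar W F \<omega>0 Uhat U"
proof -
  have "U $ i $ j * (1 - U $ i $ j) = 0" for i j
    using assms by (auto simp: binary_matrices_def)
  then have "U $ i \<bullet> (1 - U $ i) = 0" for i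
    unfolding inner_vec_def by (intro sum.neutral) (simp add: mult_eq_0_iff)
  then show ?thesis by (simp add: energy_def)
qed

section \<open>Equivalence of the relaxed and the binary problem\<close>

theorem theorem2p3:
  fixes W :: "real^'n^'n" and F :: "'n set" and \<omega>0 :: real
    and Uhat :: "real^'k^'n" and \<epsilon>bar :: real
  assumes graph: "connected_weighted_graph W"
    and degrees: "invertible (degree_mat W)"
    and classes: "CARD('k) > 2"
    and fidelity: "F \<noteq> {}" "\<omega>0 > 0"
    and labels: "\<forall>i\<in>F. \<exists>c. Uhat $ i = axis c 1"
    and \<epsilon>bar: "\<epsilon>bar < 2 / lambda_max (sym_laplacian W + fidelity_mat F \<omega>0)"
  shows "\<forall>\<epsilon>\<in>{0<..\<epsilon>bar}.
    (\<forall>U. local_minimizer (energy W F \<omega>0 Uhat \<epsilon>) simplex_set U \<or>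
          U \<in> global_minimizers (energy W F \<omega>0 Uhat \<epsilon>) simplex_set \<longrightarrow>
        strict_local_minimizer (energy W F \<omega>0 Uhat \<epsilon>) simplex_set U \<and>
        U \<in> binary_matrices) \<and>
    global_minimizers (energy W F \<omega>0 Uhat \<epsilon>) simplex_set =
      global_minimizers (energy_bar W F \<omega>0 Uhat) binary_simplex_set"
proof
  fix \<epsilon> assume \<epsilon>: "\<epsilon> \<in> {0<..\<epsilon>bar}"
  let ?E = "energy W F \<omega>0 Uhat \<epsilon>" and ?Ebar = "energy_bar W F \<omega>0 Uhat"
  let ?l = "lambda_max (sym_laplacian W + fidelity_mat F \<omega>0)"
  have sym: "transpose W = W"
    using graph by (simp add: connected_weighted_graph_def)
  have lt: "\<epsilon> < 2 / ?l" and pos: "\<epsilon> > 0"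
    using \<epsilon> \<epsilon>bar by auto
  \<comment> \<open>A positive \<open>\<epsilon>\<close> below \<open>2 / \<lambda>\<close> forces \<open>\<lambda> > 0\<close>, so the inequality can be solved for \<open>\<lambda>\<close>.\<close>
  then have "?l > 0"
    by (metis less_trans zero_less_divide_iff zero_less_numeral not_less_iff_gr_or_eq)
  with lt pos have small: "?l < 2 / \<epsilon>"
    by (simp add: field_simps)
  have concave: "?E X + ?E Y < 2 * ?E (midpoint X Y)" if "X \<noteq> Y" for X Y
    by (rule energy_strictly_midpoint_concave[OF sym fidelity(2) pos small that])
  have global_binary: "U \<in> binary_matrices" if "U \<in> global_minimizers ?E simplex_set" for U
    using local_minimizer_imp_binary[OF concave] global_minimizer_imp_local[OF that] by blast
  obtain M where M: "M \<in> simplex_set" "\<And>Y. Y \<in> simplex_set \<Longrightarrow> ?E M \<le> ?E Y"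
    using continuous_attains_inf[OF compact_simplex_set simplex_set_nonempty continuous_on_energy]
    by metis
  then have M_bin: "M \<in> binary_matrices"
    by (intro global_binary) (simp add: global_minimizers_iff)
  have "U \<in> global_minimizers ?E simplex_set \<longleftrightarrow> U \<in> global_minimizers ?Ebar binary_simplex_set"
    for U
  proof
    assume U: "U \<in> global_minimizers ?E simplex_set"
    then show "U \<in> global_minimizers ?Ebar binary_simplex_set"
      using global_binary[OF U] energy_eq_energy_bar[of _ W F \<omega>0 Uhat \<epsilon>]
      by (fastforce simp: global_minimizers_iff binary_simplex_set_eq)
  next
    assume "U \<in> global_minimizers ?Ebar binary_simplex_set"
    then have U: "U \<in> simplex_set" "U \<in> binary_matrices" and "?Ebar U \<le> ?Ebar M"
      using M M_bin by (auto simp: global_minimizers_iff binary_simplex_set_eq)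
    then have "?E U \<le> ?E M"
      using M_bin by (simp add: energy_eq_energy_bar)
    then show "U \<in> global_minimizers ?E simplex_set"
      using U M by (force simp: global_minimizers_iff)
  qed
  then have "global_minimizers ?E simplex_set = global_minimizers ?Ebar binary_simplex_set"
    by blast
  moreover have "strict_local_minimizer ?E simplex_set U \<and> U \<in> binary_matrices"
    if "local_minimizer ?E simplex_set U \<or> U \<in> global_minimizers ?E simplex_set" for U
    using that global_minimizer_imp_local local_minimizer_imp_binary[OF concave]
      local_minimizer_imp_strict[OF concave] by metis
  ultimately show "(\<forall>U. local_minimizer ?E simplex_set U \<or> U \<in> global_minimizers ?E simplex_set \<longrightarrow>
        strict_local_minimizer ?E simplex_set U \<and> U \<in> binary_matrices) \<and>
    global_minimizers ?E simplex_set = global_minimizers ?Ebar binary_simplex_set"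
    by blast
qed

end
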